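(* Let $A\subseteq\mathbb{R}$ be an open invex subset with respect to $\eta:A\times A\to\mathbb{R}$. Suppose that $f:A\to\mathbb{R}$ is a three times differentiable function, let $q\ge 1$, and suppose that $|f'''|^{q}$ is preinvex on $A$ with respect to $\eta$. Then for every $a,b\in A$ with $\eta(b,a)\neq 0$, $$\left|\int_{b}^{b+\eta(a,b)}f(x)\,dx-\eta(a,b)\,\frac{f(b)+f(b+\eta(a,b))}{2}-\frac{(\eta(a,b))^{2}}{12}\left[f'(b)-f'(b+\eta(a,b))\right]\right|\le\frac{(\eta(a,b))^{4}}{192}\left[\frac{|f'''(a)|^{q}+|f'''(b)|^{q}}{2}\right]^{\frac1q}.$$
   Context: A set $A\subseteq\mathbb{R}$ is invex with respect to $\eta:A\times A\to\mathbb{R}$ if $u+t\,\eta(v,u)\in A$ for all $u,v\in A$ and all $t\in[0,1]$. A function $g:A\to\mathbb{R}$ on an invex set $A$ is preinvex with respect to $\eta$ if $g(u+t\,\eta(v,u))\le(1-t)g(u)+t\,g(v)$ for all $u,v\in A$ and all $t\in[0,1]$. Integrals $\int_c^d$ are oriented (the upper limit may be less than the lower limit). *)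

theory Defs
  imports "HOL-Analysis.Analysis"
begin

text \<open>Functions on \<open>A\<close> and \<open>A \<times> A\<close> are total; their values outside are irrelevant.\<close>

definition invex :: "real set \<Rightarrow> (real \<Rightarrow> real \<Rightarrow> real) \<Rightarrow> bool" where
  "invex A \<eta> \<longleftrightarrow> (\<forall>u\<in>A. \<forall>v\<in>A. \<forall>t\<in>{0..1}. u + t * \<eta> v u \<in> A)"

definition preinvex_on :: "real set \<Rightarrow> (real \<Rightarrow> real \<Rightarrow> real) \<Rightarrow> (real \<Rightarrow> real) \<Rightarrow> bool" where
  "preinvex_on A \<eta> g \<longleftrightarrow>
     (\<forall>u\<in>A. \<forall>v\<in>A. \<forall>t\<in>{0..1}. g (u + t * \<eta> v u) \<le> (1 - t) * g u + t * g v)"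

text \<open>Intended for open \<open>A\<close>, where the iterates of \<^const>\<open>deriv\<close> at points of \<open>A\<close> depend
  only on the values of \<open>f\<close> on \<open>A\<close>. No continuity of the last derivative is required.\<close>

definition times_differentiable_on :: "nat \<Rightarrow> (real \<Rightarrow> real) \<Rightarrow> real set \<Rightarrow> bool" where
  "times_differentiable_on n f A \<longleftrightarrow>
     (\<forall>k<n. \<forall>x\<in>A. ((deriv ^^ k) f) field_differentiable (at x))"

end

theory Submission
  imports Defs
begin

text \<open>
  Put \<open>h = \<eta> a b\<close> and parametrise the segment by \<open>t \<mapsto> b + t * h\<close> with \<open>0 \<le> t \<le> 1\<close>. The
  left-hand side is the error of the trapezoidal rule with the first Euler--Maclaurin correction,
  whose Peano kernel is \<open>K t = t * (1 - t) * (1 - 2 * t) / 12\<close>: up to sign the error is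
  \<open>h ^ 4\<close> times the integral of \<open>K t * f''' (b + t * h)\<close>. The absolute value of \<open>K\<close> is symmetric
  about \<open>1 / 2\<close> and has integral \<open>1 / 192\<close>.

  Preinvexity bounds \<open>\<bar>f''' (b + t * h)\<bar> powr q\<close> by an affine function \<open>s t\<close> of \<open>t\<close> whose value at
  \<open>1 / 2\<close> is the mean \<open>m\<close> of the two end values. Since \<open>x \<mapsto> x powr (1 / q)\<close> is concave, it lies below
  its tangent at \<open>m\<close> (\<open>powr_inverse_le_tangent\<close>), so that \<open>\<bar>f''' (b + t * h)\<bar>\<close> is at most
  \<open>m powr (1 / q)\<close> plus a multiple of \<open>t - 1 / 2\<close>. Against a symmetric weight that multiple
  integrates to zero, which leaves \<open>m powr (1 / q) / 192\<close>. The tangent line thus does the work of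
  the power mean inequality.

  Since \<open>f'''\<close> is an arbitrary derivative, possibly discontinuous, the error is never written as
  an integral involving it. Instead \<open>corrected_trapezoid_error_affine_bound\<close> takes an explicit
  antiderivative of the kernel times the third derivative and compares its growth on either half
  of the unit interval with that of a polynomial, by the mean value inequality, for which a
  pointwise bound on \<open>f'''\<close> suffices.
\<close>

text \<open>The cubic kernel \<open>K\<close> has third derivative \<open>1\<close> and vanishes at both ends, where moreover
  \<open>K' = 1 / 12\<close>, while \<open>K''\<close> is \<open>- 1 / 2\<close> at \<open>0\<close> and \<open>1 / 2\<close> at \<open>1\<close>. These boundary values produce
  the quadrature formula when \<open>K * g3\<close> is integrated by parts three times. The bound on \<open>g3\<close> is
  allowed a linear term because \<open>\<bar>K\<bar>\<close> is symmetric about \<open>1 / 2\<close>, so that this term contributes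
  nothing.\<close>

lemma corrected_trapezoid_error_affine_bound:
  fixes G g g1 g2 g3 :: "real \<Rightarrow> real" and c d :: real
  assumes dG: "\<And>t. t \<in> {0..1} \<Longrightarrow> (G has_real_derivative g t) (at t within {0..1})"
    and dg: "\<And>t. t \<in> {0..1} \<Longrightarrow> (g has_real_derivative g1 t) (at t within {0..1})"
    and dg1: "\<And>t. t \<in> {0..1} \<Longrightarrow> (g1 has_real_derivative g2 t) (at t within {0..1})"
    and dg2: "\<And>t. t \<in> {0..1} \<Longrightarrow> (g2 has_real_derivative g3 t) (at t within {0..1})"
    and bound: "\<And>t. t \<in> {0..1} \<Longrightarrow> \<bar>g3 t\<bar> \<le> c + d * (t - 1/2)"
  shows "\<bar>G 1 - G 0 - (g 0 + g 1) / 2 - (g1 0 - g1 1) / 12\<bar> \<le> c / 192"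
proof -
  define K where "K t = t * (1 - t) * (1 - 2 * t) / 12" for t :: real
  define K' where "K' t = (1 - 6 * t + 6 * t^2) / 12" for t :: real
  \<comment> \<open>Integration by parts of \<open>K * g3\<close>, with \<open>K'' t = t - 1 / 2\<close> and \<open>K''' = 1\<close>.\<close>
  define E where "E t = K t * g2 t - K' t * g1 t + (t - 1/2) * g t - G t" for t
  \<comment> \<open>An antiderivative of \<open>K t * (c + d * (t - 1 / 2))\<close>.\<close>
  define M where "M t = c * (t^2 * (1 - t)^2 / 24)
      - d * (t^2 / 2 - 5 * t^3 / 3 + 2 * t^4 - 4 * t^5 / 5) / 24" for t
  have dE: "(E has_real_derivative K t * g3 t) (at t within {0..1})" if t: "t \<in> {0..1}" for t
  proof -
    have K: "(K has_real_derivative K' t) (at t within {0..1})"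
      unfolding K_def K'_def
      by (auto intro!: derivative_eq_intros simp: field_simps power2_eq_square)
    have K': "(K' has_real_derivative (t - 1/2)) (at t within {0..1})"
      unfolding K'_def by (auto intro!: derivative_eq_intros simp: field_simps)
    have K'': "((\<lambda>t. t - 1/2) has_real_derivative 1) (at t within {0..1})"
      by (auto intro!: derivative_eq_intros)
    show ?thesis
      unfolding E_def
      using DERIV_diff[OF DERIV_add[OF DERIV_diff[OF DERIV_mult[OF K dg2[OF t]]
            DERIV_mult[OF K' dg1[OF t]]] DERIV_mult[OF K'' dg[OF t]]] dG[OF t]]
      by (simp add: algebra_simps)
  qed
  have dM: "(M has_real_derivative K t * (c + d * (t - 1/2))) (at t within S)" for t S
    unfolding M_def K_def
    by (auto intro!: derivative_eq_intros
        simp: field_simps power2_eq_square power3_eq_cube power4_eq_xxxx)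
  have contE: "continuous_on {0..1} E"
    by (rule DERIV_continuous_on[OF dE])
  have contM: "continuous_on S M" for S
    by (rule DERIV_continuous_on[OF dM])
  \<comment> \<open>Where \<open>K\<close> has constant sign \<open>\<sigma>\<close>, the derivative of \<open>\<sigma> * M\<close> dominates that of \<open>E\<close>.\<close>
  have growth: "\<bar>E v - E u\<bar> \<le> \<sigma> * M v - \<sigma> * M u"
    if uv: "0 \<le> u" "u < v" "v \<le> 1" and sgnK: "\<And>t. t \<in> {u<..<v} \<Longrightarrow> \<bar>K t\<bar> = \<sigma> * K t"
    for u v \<sigma>
  proof -
    have at_E: "(E has_vector_derivative K t * g3 t) (at t)" if "u < t" "t < v" for t
      using dE[of t] that uv at_within_Icc_at[of 0 t 1]
      by (auto simp: has_real_derivative_iff_has_vector_derivative)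
    have at_M: "((\<lambda>x. \<sigma> * M x) has_vector_derivative \<sigma> * (K t * (c + d * (t - 1/2)))) (at t)" for t
      using DERIV_cmult[OF dM[of t UNIV], of \<sigma>]
      by (simp add: has_real_derivative_iff_has_vector_derivative)
    have le: "norm (K t * g3 t) \<le> \<sigma> * (K t * (c + d * (t - 1/2)))" if "u < t" "t < v" for t
    proof -
      have "norm (K t * g3 t) = \<bar>K t\<bar> * \<bar>g3 t\<bar>" by (simp add: abs_mult)
      also have "\<dots> \<le> \<bar>K t\<bar> * (c + d * (t - 1/2))"
        using bound[of t] that uv by (intro mult_left_mono) auto
      finally show ?thesis using sgnK[of t] that by simp
    qed
    have "norm (E v - E u) \<le> \<sigma> * M v - \<sigma> * M u"
      by (rule differentiable_bound_general[OF uv(2) _ _ at_E at_M le])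
        (use uv in \<open>auto intro!: continuous_intros contM continuous_on_subset[OF contE]\<close>)
    then show ?thesis by simp
  qed
  \<comment> \<open>\<open>K\<close> changes sign only at \<open>1 / 2\<close>. The two bounds add up to \<open>c / 192\<close> because the increments
    of the coefficient of \<open>d\<close> in \<open>M\<close> over the two halves agree and cancel.\<close>
  have "\<bar>E (1/2) - E 0\<bar> \<le> 1 * M (1/2) - 1 * M 0"
    by (rule growth) (auto simp: K_def)
  moreover have "\<bar>E 1 - E (1/2)\<bar> \<le> (-1) * M 1 - (-1) * M (1/2)"
  proof (rule growth)
    fix t :: real assume "t \<in> {1/2<..<1}"
    then have "K t \<le> 0"
      by (auto simp: K_def intro: mult_nonneg_nonpos)
    then show "\<bar>K t\<bar> = (-1) * K t" by simp
  qed simp_all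
  ultimately have "\<bar>E 1 - E 0\<bar> \<le> 2 * M (1/2) - M 0 - M 1" by linarith
  also have "\<dots> = c / 192"
    by (simp add: M_def field_simps power2_eq_square power3_eq_cube power4_eq_xxxx)
  finally have "\<bar>E 1 - E 0\<bar> \<le> c / 192" .
  moreover have "E 1 - E 0 = - (G 1 - G 0 - (g 0 + g 1) / 2 - (g1 0 - g1 1) / 12)"
    by (simp add: E_def K_def K'_def field_simps)
  ultimately show ?thesis by (simp only: abs_minus_cancel)
qed

text \<open>The right-hand side is the tangent at \<open>m\<close> of the concave function \<open>x \<mapsto> x powr (1 / q)\<close>.
  The inequality is Young's inequality for \<open>s\<close> and \<open>m\<close> divided by \<open>m powr (1 - 1 / q)\<close>.\<close>

lemma powr_inverse_le_tangent:
  fixes q s m :: real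
  assumes "q \<ge> 1" "s \<ge> 0" "m > 0"
  shows "s powr (1/q) \<le> m powr (1/q) + m powr (1/q - 1) / q * (s - m)"
proof -
  have young: "s powr (1/q) * m powr (1 - 1/q) \<le> 1/q * s + (1 - 1/q) * m"
  proof (cases "s = 0")
    case True
    then show ?thesis using assms by simp
  next
    case False
    then show ?thesis using assms by (intro Youngs_inequality_0) auto
  qed
  have cancel: "m powr (1 - 1/q) * m powr (1/q - 1) = 1"
    using assms by (simp add: powr_add[symmetric])
  have shift: "m * m powr (1/q - 1) = m powr (1/q)"
    using assms by (simp add: powr_mult_base)
  have "s powr (1/q) = s powr (1/q) * m powr (1 - 1/q) * m powr (1/q - 1)"
    using cancel by (simp add: mult.assoc)
  also have "\<dots> \<le> (1/q * s + (1 - 1/q) * m) * m powr (1/q - 1)"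
    using young by (intro mult_right_mono) auto
  also have "\<dots> = m * m powr (1/q - 1) + m powr (1/q - 1) / q * (s - m)"
    by (simp add: algebra_simps diff_divide_distrib)
  finally show ?thesis by (simp only: shift)
qed

text \<open>Take the tangent at the mean of \<open>p\<close> and \<open>r\<close>: the affine bound deviates from that mean by
  \<open>(r - p) * (t - 1 / 2)\<close>. A vanishing mean is treated separately, since \<open>x \<mapsto> x powr (1 / q)\<close>
  has no tangent of finite slope at \<open>0\<close> when \<open>q > 1\<close>; but then \<open>p = r = 0\<close> forces \<open>y = 0\<close> on the
  unit interval.\<close>

lemma affine_bound_of_powr_bound:
  fixes y :: "real \<Rightarrow> real" and p r q :: real
  assumes q: "q \<ge> 1" and pr: "p \<ge> 0" "r \<ge> 0"
    and y: "\<And>t. t \<in> {0..1} \<Longrightarrow> \<bar>y t\<bar> powr q \<le> (1 - t) * p + t * r"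
  obtains d where "\<And>t. t \<in> {0..1} \<Longrightarrow> \<bar>y t\<bar> \<le> ((r + p) / 2) powr (1/q) + d * (t - 1/2)"
proof (cases "(r + p) / 2 = 0")
  case True
  then have "p = 0" "r = 0" using pr by auto
  then have "\<bar>y t\<bar> \<le> ((r + p) / 2) powr (1/q) + 0 * (t - 1/2)" if "t \<in> {0..1}" for t
    using y[OF that] by (simp add: le_less)
  then show ?thesis by (rule that)
next
  case False
  define m where "m = (r + p) / 2"
  have m: "m > 0" using False pr by (auto simp: m_def)
  define k where "k = m powr (1/q - 1) / q"
  have k: "k \<ge> 0" using q by (simp add: k_def)
  have "\<bar>y t\<bar> \<le> m powr (1/q) + (k * (r - p)) * (t - 1/2)" if t: "t \<in> {0..1}" for t
  proof -
    have "\<bar>y t\<bar> = (\<bar>y t\<bar> powr q) powr (1/q)"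
      using q by (simp add: powr_powr)
    also have "\<dots> \<le> m powr (1/q) + k * (\<bar>y t\<bar> powr q - m)"
      unfolding k_def using q m by (intro powr_inverse_le_tangent) auto
    also have "\<dots> \<le> m powr (1/q) + k * (((1 - t) * p + t * r) - m)"
      using y[OF t] k by (intro add_left_mono mult_left_mono) auto
    also have "\<dots> = m powr (1/q) + (k * (r - p)) * (t - 1/2)"
      by (simp add: m_def field_simps)
    finally show ?thesis .
  qed
  then show ?thesis unfolding m_def by (rule that)
qed

lemma has_real_derivative_along_segment:
  fixes F :: "real \<Rightarrow> real" and b h :: real
  assumes "(F has_real_derivative D) (at (b + t * h) within S)"
    and "(\<lambda>t. b + t * h) ` T \<subseteq> S"
  shows "((\<lambda>t. F (b + t * h)) has_real_derivative h * D) (at t within T)"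
proof -
  have "(F has_real_derivative D) (at (b + t * h) within (\<lambda>t. b + t * h) ` T)"
    using assms by (rule DERIV_subset)
  moreover have "((\<lambda>t. b + t * h) has_real_derivative h) (at t within T)"
    by (auto intro!: derivative_eq_intros)
  ultimately have "((F \<circ> (\<lambda>t. b + t * h)) has_real_derivative D * h) (at t within T)"
    by (rule DERIV_image_chain)
  then show ?thesis by (simp add: o_def mult.commute)
qed

theorem theorem1:
  fixes A :: "real set" and \<eta> :: "real \<Rightarrow> real \<Rightarrow> real" and f :: "real \<Rightarrow> real"
    and q a b :: real
  assumes "open A"
    and "invex A \<eta>"
    and "times_differentiable_on 3 f A"
    and "q \<ge> 1"
    and "preinvex_on A \<eta> (\<lambda>x. \<bar>(deriv ^^ 3) f x\<bar> powr q)"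
    and "a \<in> A" and "b \<in> A"
    and "\<eta> b a \<noteq> 0"
  shows "\<bar>(LBINT x=b..b + \<eta> a b. f x)
            - \<eta> a b * ((f b + f (b + \<eta> a b)) / 2)
            - (\<eta> a b)\<^sup>2 / 12 * (deriv f b - deriv f (b + \<eta> a b))\<bar>
         \<le> (\<eta> a b) ^ 4 / 192 *
            ((\<bar>(deriv ^^ 3) f a\<bar> powr q + \<bar>(deriv ^^ 3) f b\<bar> powr q) / 2) powr (1 / q)"
proof -
  define h where "h = \<eta> a b"
  define S where "S = {min b (b + h)..max b (b + h)}"
  define f3 where "f3 = (deriv ^^ 3) f"
  define C where "C = ((\<bar>f3 a\<bar> powr q + \<bar>f3 b\<bar> powr q) / 2) powr (1/q)"
  have inA: "b + t * h \<in> A" if "t \<in> {0..1}" for t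
    using assms that by (auto simp: invex_def h_def)
  have image: "(\<lambda>t. b + t * h) ` {0..1} = S"
  proof -
    have "S = closed_segment b (b + h)"
      unfolding closed_segment_eq_real_ivl S_def by (simp add: min_def max_def)
    also have "\<dots> = (\<lambda>t. b + t * h) ` {0..1}"
      unfolding closed_segment_real_eq by (intro image_cong) (simp_all add: algebra_simps)
    finally show ?thesis by (rule sym)
  qed
  have SA: "S \<subseteq> A" using inA image by blast
  have d: "((deriv ^^ k) f has_real_derivative (deriv ^^ Suc k) f x) (at x)"
    if "k < 3" "x \<in> A" for k x
    using assms(3) that by (auto simp: times_differentiable_on_def field_differentiable_derivI)
  have d0: "(f has_real_derivative deriv f x) (at x)" if "x \<in> A" for x
    using d[of 0] that by simp
  have d1: "(deriv f has_real_derivative deriv (deriv f) x) (at x)" if "x \<in> A" for x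
    using d[of 1] that by simp
  have d2: "(deriv (deriv f) has_real_derivative f3 x) (at x)" if "x \<in> A" for x
    using d[of 2] that by (simp add: f3_def numeral_2_eq_2 numeral_3_eq_3)
  have contf: "continuous_on S f"
    using d0 SA by (meson DERIV_isCont continuous_at_imp_continuous_on subsetD)
  obtain F where F: "\<And>x. x \<in> S \<Longrightarrow> (F has_vector_derivative f x) (at x within S)"
    using antiderivative_continuous contf unfolding S_def by blast
  have int: "(LBINT x=b..b + h. f x) = F (b + h) - F b"
    using interval_integral_FTC_finite[of b "b + h" f F] contf F by (simp add: S_def)
  have powr_bound: "\<bar>f3 (b + t * h)\<bar> powr q \<le> (1 - t) * \<bar>f3 b\<bar> powr q + t * \<bar>f3 a\<bar> powr q"
    if "t \<in> {0..1}" for t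
    using assms that unfolding preinvex_on_def h_def f3_def by blast
  obtain e where e: "\<And>t. t \<in> {0..1} \<Longrightarrow> \<bar>f3 (b + t * h)\<bar> \<le> C + e * (t - 1/2)"
    using affine_bound_of_powr_bound[OF \<open>q \<ge> 1\<close> _ _ powr_bound] unfolding C_def by auto
  have "\<bar>F (b + 1 * h) - F (b + 0 * h) - (h * f (b + 0 * h) + h * f (b + 1 * h)) / 2
      - (h^2 * deriv f (b + 0 * h) - h^2 * deriv f (b + 1 * h)) / 12\<bar> \<le> (h^4 * C) / 192"
  proof (rule corrected_trapezoid_error_affine_bound
      [where g = "\<lambda>t. h * f (b + t * h)" and ?g1.0 = "\<lambda>t. h^2 * deriv f (b + t * h)"
         and ?g2.0 = "\<lambda>t. h^3 * deriv (deriv f) (b + t * h)" and ?g3.0 = "\<lambda>t. h^4 * f3 (b + t * h)"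
         and d = "h^4 * e"])
    fix t :: real assume t: "t \<in> {0..1}"
    note chain = has_real_derivative_along_segment[where b = b and h = h and t = t and T = "{0..1}"]
    have "b + t * h \<in> S" using image t by blast
    then show "((\<lambda>t. F (b + t * h)) has_real_derivative h * f (b + t * h)) (at t within {0..1})"
      using F image
      by (intro chain[where S = S]) (auto simp: has_real_derivative_iff_has_vector_derivative)
    show "((\<lambda>t. h * f (b + t * h)) has_real_derivative h^2 * deriv f (b + t * h))
        (at t within {0..1})"
      using DERIV_cmult[OF chain[OF d0[OF inA[OF t]]], of h]
      by (simp add: power2_eq_square mult.assoc)
    show "((\<lambda>t. h^2 * deriv f (b + t * h)) has_real_derivative h^3 * deriv (deriv f) (b + t * h))
        (at t within {0..1})"
      using DERIV_cmult[OF chain[OF d1[OF inA[OF t]]], of "h^2"]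
      by (simp add: eval_nat_numeral mult.assoc)
    show "((\<lambda>t. h^3 * deriv (deriv f) (b + t * h)) has_real_derivative h^4 * f3 (b + t * h))
        (at t within {0..1})"
      using DERIV_cmult[OF chain[OF d2[OF inA[OF t]]], of "h^3"]
      by (simp add: eval_nat_numeral mult.assoc)
    have "\<bar>h^4 * f3 (b + t * h)\<bar> = h^4 * \<bar>f3 (b + t * h)\<bar>" by (simp add: abs_mult)
    also have "\<dots> \<le> h^4 * (C + e * (t - 1/2))"
      using e[OF t] by (intro mult_left_mono) auto
    finally show "\<bar>h^4 * f3 (b + t * h)\<bar> \<le> h^4 * C + h^4 * e * (t - 1/2)"
      by (simp add: algebra_simps)
  qed
  then have "\<bar>(LBINT x=b..b + h. f x) - h * ((f b + f (b + h)) / 2)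
      - h^2 / 12 * (deriv f b - deriv f (b + h))\<bar> \<le> h^4 / 192 * C"
    unfolding int by (simp add: algebra_simps)
  then show ?thesis unfolding C_def h_def f3_def .
qed

end
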